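(* Let $F:\mathcal{C}\to\mathcal{B}$ and $G:\mathcal{B}\to\mathcal{A}$ be functors. (i) If $F$ and $G$ are h-separable, so is $GF$. (ii) If $GF$ is h-separable, so is $F$. (iii) If $G$ is h-separable, then $F$ is h-separable if and only if $GF$ is h-separable.
   Context: A functor $F:\mathcal{B}\to\mathcal{A}$ is h-separable (heavily separable) if there are maps $P_{X,Y}:\mathrm{Hom}_{\mathcal{A}}(FX,FY)\to\mathrm{Hom}_{\mathcal{B}}(X,Y)$, natural in $X,Y\in\mathcal{B}$, such that $P_{X,Y}(Ff)=f$ for every $f:X\to Y$ in $\mathcal{B}$, and $P_{X,Z}(f\circ g)=P_{Y,Z}(f)\circ P_{X,Y}(g)$ for all $X,Y,Z\in\mathcal{B}$ and all $g:FX\to FY$, $f:FY\to FZ$ in $\mathcal{A}$. *)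

theory Defs
  imports Main
begin

record ('o, 'm) cat =
  Obj :: "'o set"
  Arr :: "'m set"
  Dom :: "'m \<Rightarrow> 'o"
  Cod :: "'m \<Rightarrow> 'o"
  Ident :: "'o \<Rightarrow> 'm"
  Comp :: "'m \<Rightarrow> 'm \<Rightarrow> 'm"  (infixr "\<cdot>\<index>" 70)

definition Hom :: "('o, 'm, 'x) cat_scheme \<Rightarrow> 'o \<Rightarrow> 'o \<Rightarrow> 'm set" where
  "Hom C X Y = {f \<in> Arr C. Dom C f = X \<and> Cod C f = Y}"

text \<open>Composition is in the usual order: \<open>g \<cdot> f\<close> means first \<open>f\<close>, then \<open>g\<close>.\<close>

locale category =
  fixes C :: "('o, 'm, 'x) cat_scheme" (structure)
  assumes Dom_Obj: "f \<in> Arr C \<Longrightarrow> Dom C f \<in> Obj C"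
    and Cod_Obj: "f \<in> Arr C \<Longrightarrow> Cod C f \<in> Obj C"
    and Ident_Hom: "X \<in> Obj C \<Longrightarrow> Ident C X \<in> Hom C X X"
    and Comp_Hom: "f \<in> Hom C X Y \<Longrightarrow> g \<in> Hom C Y Z \<Longrightarrow> g \<cdot> f \<in> Hom C X Z"
    and Comp_Ident_left: "f \<in> Hom C X Y \<Longrightarrow> Ident C Y \<cdot> f = f"
    and Comp_Ident_right: "f \<in> Hom C X Y \<Longrightarrow> f \<cdot> Ident C X = f"
    and Comp_assoc:
      "f \<in> Hom C W X \<Longrightarrow> g \<in> Hom C X Y \<Longrightarrow> h \<in> Hom C Y Z \<Longrightarrow> (h \<cdot> g) \<cdot> f = h \<cdot> (g \<cdot> f)"

record ('o1, 'm1, 'o2, 'm2) fctr =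
  on_obj :: "'o1 \<Rightarrow> 'o2"
  on_arr :: "'m1 \<Rightarrow> 'm2"

locale cat_functor = B: category B + A: category A
  for B :: "('o1, 'm1, 'x) cat_scheme" and A :: "('o2, 'm2, 'y) cat_scheme" +
  fixes F :: "('o1, 'm1, 'o2, 'm2) fctr"
  assumes on_obj_Obj: "X \<in> Obj B \<Longrightarrow> on_obj F X \<in> Obj A"
    and on_arr_Hom: "f \<in> Hom B X Y \<Longrightarrow> on_arr F f \<in> Hom A (on_obj F X) (on_obj F Y)"
    and on_arr_Ident: "X \<in> Obj B \<Longrightarrow> on_arr F (Ident B X) = Ident A (on_obj F X)"
    and on_arr_Comp: "f \<in> Hom B X Y \<Longrightarrow> g \<in> Hom B Y Z \<Longrightarrow>
      on_arr F (g \<cdot>\<^bsub>B\<^esub> f) = on_arr F g \<cdot>\<^bsub>A\<^esub> on_arr F f"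

definition fctr_comp ::
  "('o2, 'm2, 'o3, 'm3) fctr \<Rightarrow> ('o1, 'm1, 'o2, 'm2) fctr \<Rightarrow> ('o1, 'm1, 'o3, 'm3) fctr"
  (infixr "\<circ>\<^sub>F" 75) where
  "G \<circ>\<^sub>F F = \<lparr>on_obj = on_obj G \<circ> on_obj F, on_arr = on_arr G \<circ> on_arr F\<rparr>"

lemma cat_functor_fctr_comp:
  assumes "cat_functor C B F" and "cat_functor B A G"
  shows "cat_functor C A (G \<circ>\<^sub>F F)"
proof -
  interpret F: cat_functor C B F by fact
  interpret G: cat_functor B A G by fact
  show ?thesis
    by unfold_locales
      (auto simp: fctr_comp_def F.on_obj_Obj G.on_obj_Obj F.on_arr_Ident G.on_arr_Ident
        F.on_arr_Comp G.on_arr_Comp[OF F.on_arr_Hom F.on_arr_Hom]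
        intro!: F.on_arr_Hom G.on_arr_Hom)
qed

text \<open>
  The maps \<open>P X Y : Hom A (F X) (F Y) \<rightarrow> Hom B X Y\<close> are indexed by the objects of \<open>B\<close>, since \<open>X\<close> and
  \<open>Y\<close> need not be determined by \<open>F X\<close> and \<open>F Y\<close>. Naturality is that of a transformation
  \<open>Hom A (F -) (F -) \<rightarrow> Hom B - -\<close> of functors on the product of the opposite of \<open>B\<close> with \<open>B\<close>.
\<close>

definition natural_hom_maps ::
  "('o1, 'm1, 'x) cat_scheme \<Rightarrow> ('o2, 'm2, 'y) cat_scheme \<Rightarrow> ('o1, 'm1, 'o2, 'm2) fctr
    \<Rightarrow> ('o1 \<Rightarrow> 'o1 \<Rightarrow> 'm2 \<Rightarrow> 'm1) \<Rightarrow> bool" where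
  "natural_hom_maps B A F P \<longleftrightarrow>
    (\<forall>X\<in>Obj B. \<forall>Y\<in>Obj B. \<forall>f\<in>Hom A (on_obj F X) (on_obj F Y). P X Y f \<in> Hom B X Y) \<and>
    (\<forall>X\<in>Obj B. \<forall>Y\<in>Obj B. \<forall>X'\<in>Obj B. \<forall>Y'\<in>Obj B.
      \<forall>h\<in>Hom B X' X. \<forall>k\<in>Hom B Y Y'. \<forall>f\<in>Hom A (on_obj F X) (on_obj F Y).
        P X' Y' (on_arr F k \<cdot>\<^bsub>A\<^esub> f \<cdot>\<^bsub>A\<^esub> on_arr F h) = k \<cdot>\<^bsub>B\<^esub> P X Y f \<cdot>\<^bsub>B\<^esub> h)"

definition h_separable ::
  "('o1, 'm1, 'x) cat_scheme \<Rightarrow> ('o2, 'm2, 'y) cat_scheme \<Rightarrow> ('o1, 'm1, 'o2, 'm2) fctr \<Rightarrow> bool" where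
  "h_separable B A F \<longleftrightarrow>
    (\<exists>P. natural_hom_maps B A F P \<and>
      (\<forall>X\<in>Obj B. \<forall>Y\<in>Obj B. \<forall>f\<in>Hom B X Y. P X Y (on_arr F f) = f) \<and>
      (\<forall>X\<in>Obj B. \<forall>Y\<in>Obj B. \<forall>Z\<in>Obj B.
        \<forall>g\<in>Hom A (on_obj F X) (on_obj F Y). \<forall>f\<in>Hom A (on_obj F Y) (on_obj F Z).
          P X Z (f \<cdot>\<^bsub>A\<^esub> g) = P Y Z f \<cdot>\<^bsub>B\<^esub> P X Y g))"

end

theory Submission
  imports Defs
begin

text \<open>
  The proof rests on one observation: naturality of the maps \<open>P\<close> in the definition of h-separability
  is automatic. If \<open>P\<close> respects composition and sends each \<open>F f\<close> back to \<open>f\<close>, then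
  \<open>P (F k \<cdot> f \<cdot> F h) = P (F k) \<cdot> P f \<cdot> P (F h) = k \<cdot> P f \<cdot> h\<close>. Hence an h-separable functor is just
  one that admits a multiplicative retraction of its action on arrows
  (\<open>h_separable_iff_multiplicative_retraction\<close>), and the claims become statements about retractions:
  retractions for \<open>F\<close> and for \<open>G\<close> compose, in the opposite order, to one for \<open>G \<circ>\<^sub>F F\<close>, and a
  retraction for \<open>G \<circ>\<^sub>F F\<close> becomes one for \<open>F\<close> by precomposing with the action of \<open>G\<close> on arrows.
  The third claim combines the other two.
\<close>

definition multiplicative_retraction ::
  "('o1, 'm1, 'x) cat_scheme \<Rightarrow> ('o2, 'm2, 'y) cat_scheme \<Rightarrow> ('o1, 'm1, 'o2, 'm2) fctr
    \<Rightarrow> ('o1 \<Rightarrow> 'o1 \<Rightarrow> 'm2 \<Rightarrow> 'm1) \<Rightarrow> bool" where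
  "multiplicative_retraction B A F P \<longleftrightarrow>
    (\<forall>X\<in>Obj B. \<forall>Y\<in>Obj B. \<forall>f\<in>Hom A (on_obj F X) (on_obj F Y). P X Y f \<in> Hom B X Y) \<and>
    (\<forall>X\<in>Obj B. \<forall>Y\<in>Obj B. \<forall>f\<in>Hom B X Y. P X Y (on_arr F f) = f) \<and>
    (\<forall>X\<in>Obj B. \<forall>Y\<in>Obj B. \<forall>Z\<in>Obj B.
      \<forall>g\<in>Hom A (on_obj F X) (on_obj F Y). \<forall>f\<in>Hom A (on_obj F Y) (on_obj F Z).
        P X Z (f \<cdot>\<^bsub>A\<^esub> g) = P Y Z f \<cdot>\<^bsub>B\<^esub> P X Y g)"

text \<open>
  Naturality follows by splitting \<open>F k \<cdot> f \<cdot> F h\<close> with multiplicativity and cancelling \<open>F\<close> on the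
  outer factors with the retraction property.
\<close>

lemma (in cat_functor) multiplicative_retraction_natural:
  assumes "multiplicative_retraction B A F P"
  shows "natural_hom_maps B A F P"
proof -
  have P_Hom: "P X Y f \<in> Hom B X Y"
    if "X \<in> Obj B" "Y \<in> Obj B" "f \<in> Hom A (on_obj F X) (on_obj F Y)" for X Y f
    using assms that unfolding multiplicative_retraction_def by blast
  have P_on_arr: "P X Y (on_arr F f) = f"
    if "X \<in> Obj B" "Y \<in> Obj B" "f \<in> Hom B X Y" for X Y f
    using assms that unfolding multiplicative_retraction_def by blast
  have P_Comp: "P X Z (f \<cdot>\<^bsub>A\<^esub> g) = P Y Z f \<cdot>\<^bsub>B\<^esub> P X Y g"
    if "X \<in> Obj B" "Y \<in> Obj B" "Z \<in> Obj B"
      "g \<in> Hom A (on_obj F X) (on_obj F Y)" "f \<in> Hom A (on_obj F Y) (on_obj F Z)" for X Y Z f g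
    using assms that unfolding multiplicative_retraction_def by blast
  have "P X' Y' (on_arr F k \<cdot>\<^bsub>A\<^esub> f \<cdot>\<^bsub>A\<^esub> on_arr F h) = k \<cdot>\<^bsub>B\<^esub> P X Y f \<cdot>\<^bsub>B\<^esub> h"
    if obj: "X \<in> Obj B" "Y \<in> Obj B" "X' \<in> Obj B" "Y' \<in> Obj B"
      and h: "h \<in> Hom B X' X" and k: "k \<in> Hom B Y Y'"
      and f: "f \<in> Hom A (on_obj F X) (on_obj F Y)" for X Y X' Y' h k f
  proof -
    note Fh = on_arr_Hom[OF h] and Fk = on_arr_Hom[OF k]
    have "P X' Y' (on_arr F k \<cdot>\<^bsub>A\<^esub> f \<cdot>\<^bsub>A\<^esub> on_arr F h)
        = P Y Y' (on_arr F k) \<cdot>\<^bsub>B\<^esub> P X' Y (f \<cdot>\<^bsub>A\<^esub> on_arr F h)"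
      using P_Comp obj A.Comp_Hom[OF Fh f] Fk by blast
    also have "P X' Y (f \<cdot>\<^bsub>A\<^esub> on_arr F h) = P X Y f \<cdot>\<^bsub>B\<^esub> P X' X (on_arr F h)"
      using P_Comp obj Fh f by blast
    finally show ?thesis
      using P_on_arr obj h k by simp
  qed
  with P_Hom show ?thesis
    unfolding natural_hom_maps_def by blast
qed

lemma (in cat_functor) h_separable_iff_multiplicative_retraction:
  "h_separable B A F \<longleftrightarrow> (\<exists>P. multiplicative_retraction B A F P)"
proof
  assume "h_separable B A F"
  then show "\<exists>P. multiplicative_retraction B A F P"
    unfolding h_separable_def natural_hom_maps_def multiplicative_retraction_def by blast
next
  assume "\<exists>P. multiplicative_retraction B A F P"
  then obtain P where P: "multiplicative_retraction B A F P" ..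
  then show "h_separable B A F"
    using multiplicative_retraction_natural[OF P]
    unfolding h_separable_def multiplicative_retraction_def by blast
qed

text \<open>
  An arrow \<open>G (F X) \<rightarrow> G (F Y)\<close> is pulled back to \<open>F X \<rightarrow> F Y\<close> by the retraction \<open>Q\<close> for \<open>G\<close>, taken
  at the objects \<open>F X\<close> and \<open>F Y\<close>, and then to \<open>X \<rightarrow> Y\<close> by the retraction \<open>P\<close> for \<open>F\<close>.
\<close>

lemma multiplicative_retraction_fctr_comp:
  assumes "cat_functor C B F"
    and P: "multiplicative_retraction C B F P" and Q: "multiplicative_retraction B A G Q"
  shows "multiplicative_retraction C A (G \<circ>\<^sub>F F)
    (\<lambda>X Y f. P X Y (Q (on_obj F X) (on_obj F Y) f))"
proof -
  interpret F: cat_functor C B F by fact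
  show ?thesis
    unfolding multiplicative_retraction_def
  proof (intro conjI ballI)
    fix X Y f
    assume obj: "X \<in> Obj C" "Y \<in> Obj C"
      and "f \<in> Hom A (on_obj (G \<circ>\<^sub>F F) X) (on_obj (G \<circ>\<^sub>F F) Y)"
    then have "Q (on_obj F X) (on_obj F Y) f \<in> Hom B (on_obj F X) (on_obj F Y)"
      using Q by (simp add: multiplicative_retraction_def fctr_comp_def F.on_obj_Obj)
    then show "P X Y (Q (on_obj F X) (on_obj F Y) f) \<in> Hom C X Y"
      using P obj by (simp add: multiplicative_retraction_def)
  next
    fix X Y f
    assume "X \<in> Obj C" "Y \<in> Obj C" "f \<in> Hom C X Y"
    then show "P X Y (Q (on_obj F X) (on_obj F Y) (on_arr (G \<circ>\<^sub>F F) f)) = f"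
      using P Q
      by (simp add: multiplicative_retraction_def fctr_comp_def F.on_obj_Obj F.on_arr_Hom)
  next
    fix X Y Z g f
    assume obj: "X \<in> Obj C" "Y \<in> Obj C" "Z \<in> Obj C"
      and "g \<in> Hom A (on_obj (G \<circ>\<^sub>F F) X) (on_obj (G \<circ>\<^sub>F F) Y)"
      and "f \<in> Hom A (on_obj (G \<circ>\<^sub>F F) Y) (on_obj (G \<circ>\<^sub>F F) Z)"
    then have g: "g \<in> Hom A (on_obj G (on_obj F X)) (on_obj G (on_obj F Y))"
      and f: "f \<in> Hom A (on_obj G (on_obj F Y)) (on_obj G (on_obj F Z))"
      by (simp_all add: fctr_comp_def)
    have "Q (on_obj F X) (on_obj F Z) (f \<cdot>\<^bsub>A\<^esub> g)
        = Q (on_obj F Y) (on_obj F Z) f \<cdot>\<^bsub>B\<^esub> Q (on_obj F X) (on_obj F Y) g"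
      using Q obj[THEN F.on_obj_Obj] g f unfolding multiplicative_retraction_def by blast
    moreover have "Q (on_obj F X) (on_obj F Y) g \<in> Hom B (on_obj F X) (on_obj F Y)"
      and "Q (on_obj F Y) (on_obj F Z) f \<in> Hom B (on_obj F Y) (on_obj F Z)"
      using Q obj[THEN F.on_obj_Obj] g f unfolding multiplicative_retraction_def by blast+
    ultimately show "P X Z (Q (on_obj F X) (on_obj F Z) (f \<cdot>\<^bsub>A\<^esub> g))
        = P Y Z (Q (on_obj F Y) (on_obj F Z) f) \<cdot>\<^bsub>C\<^esub> P X Y (Q (on_obj F X) (on_obj F Y) g)"
      using P obj unfolding multiplicative_retraction_def by simp
  qed
qed

text \<open>
  Functoriality of \<open>G\<close> makes \<open>f \<mapsto> R (G f)\<close> multiplicative, and \<open>R (G (F f)) = f\<close> is already the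
  retraction property for \<open>F\<close>.
\<close>

lemma multiplicative_retraction_fctr_comp_first:
  assumes "cat_functor C B F" and "cat_functor B A G"
    and R: "multiplicative_retraction C A (G \<circ>\<^sub>F F) R"
  shows "multiplicative_retraction C B F (\<lambda>X Y f. R X Y (on_arr G f))"
proof -
  interpret F: cat_functor C B F by fact
  interpret G: cat_functor B A G by fact
  show ?thesis
    using R unfolding multiplicative_retraction_def
    by (simp add: fctr_comp_def G.on_arr_Hom G.on_arr_Comp)
qed

theorem lemma1p4:
  fixes C :: "('oc, 'mc) cat" and B :: "('ob, 'mb) cat" and A :: "('oa, 'ma) cat"
    and F :: "('oc, 'mc, 'ob, 'mb) fctr" and G :: "('ob, 'mb, 'oa, 'ma) fctr"
  assumes "cat_functor C B F" and "cat_functor B A G"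
  shows "(h_separable C B F \<and> h_separable B A G \<longrightarrow> h_separable C A (G \<circ>\<^sub>F F)) \<and>
    (h_separable C A (G \<circ>\<^sub>F F) \<longrightarrow> h_separable C B F) \<and>
    (h_separable B A G \<longrightarrow> (h_separable C B F \<longleftrightarrow> h_separable C A (G \<circ>\<^sub>F F)))"
proof -
  note retraction_iff = cat_functor.h_separable_iff_multiplicative_retraction
  have comp: "h_separable C A (G \<circ>\<^sub>F F)" if "h_separable C B F" "h_separable B A G"
    using that multiplicative_retraction_fctr_comp[OF assms(1)]
    unfolding retraction_iff[OF assms(1)] retraction_iff[OF assms(2)]
      retraction_iff[OF cat_functor_fctr_comp[OF assms]]
    by blast
  have first: "h_separable C B F" if "h_separable C A (G \<circ>\<^sub>F F)"
    using that multiplicative_retraction_fctr_comp_first[OF assms]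
    unfolding retraction_iff[OF assms(1)] retraction_iff[OF cat_functor_fctr_comp[OF assms]]
    by blast
  from comp first show ?thesis by blast
qed

end
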